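(* Let $n\in\mathbb{N}$ and $u,v\in\mathcal{A}_n^*$. Then $u$ and $v$ lie in the same connected component of the quasi-crystal graph $\Gamma_n$ if and only if $\mathrm{RR}(u)=\mathrm{RR}(v)$.
   Context: Let $\mathcal{A}_n=\{1<2<\dots<n\}$ and $\mathcal{A}_n^*$ the free monoid over it. For $i\in\{1,\dots,n-1\}$, a word $u$ has an $i$-inversion if it contains a letter $i+1$ to the left of a letter $i$. Quasi-Kashiwara operators: if $u$ has an $i$-inversion, $e_i(u),f_i(u)$ are undefined; otherwise $e_i(u)$ replaces the leftmost letter $i+1$ of $u$ by $i$ (undefined if none) and $f_i(u)$ replaces the rightmost letter $i$ by $i+1$ (undefined if none). The quasi-crystal graph $\Gamma_n$ has vertex set $\mathcal{A}_n^*$ and an edge $u\to f_i(u)$ labelled $i$ whenever defined. Quasi-ribbon tableaux: a composition $\alpha=(\alpha_1,\dots,\alpha_k)$ determines a ribbon diagram with $\alpha_h$ boxes in row $h$, the leftmost box of each row directly below the rightmost box of the previous row. A quasi-ribbon tableau is such a diagram filled with positive integers, rows weakly increasing left to right, columns strictly increasing top to bottom; cells listed along the ribbon (top-left to bottom-right) have weakly increasing entries. Insertion of $a$ into $T$: if no entry of $T$ is $\le a$ (or $T$ empty), create a cell $a$ and attach $T$ with its first cell directly below $a$; if no entry is $>a$, attach a new cell $a$ directly right of the last cell of $T$; otherwise let $x$ be the last cell with entry $\le a$ and $z$ the next cell, and form: the part of $T$ up to $x$, a new cell $a$ directly right of $x$, then the rest of $T$ from $z$ on attached with $z$ directly below the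 new cell. For $w=a_1\cdots a_k$, starting from the empty tableau $Q_0$ and empty ribbon $R_0$, let $Q_i$ be the result of inserting $a_i$ into $Q_{i-1}$, and let $R_i$ be obtained from $R_{i-1}$ by the same structural modification (adding a new cell at the same place as the new cell of $Q_i$), the new cell being filled with $i$. The recording ribbon is $\mathrm{RR}(w)=R_k$ (it has the same shape as $Q_k$). *)

theory Defs
  imports "Graph_Theory.Digraph_Component"
begin

definition words :: "nat \<Rightarrow> nat list set" where
  "words n = lists {1..n}"

definition has_inversion :: "nat \<Rightarrow> nat list \<Rightarrow> bool" where
  "has_inversion i u \<longleftrightarrow>
     (\<exists>j k. j < k \<and> k < length u \<and> u ! j = i + 1 \<and> u ! k = i)"

text \<open>The quasi-Kashiwara operator \<open>f\<^sub>i\<close>; \<open>None\<close> means undefined.\<close>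

definition quasi_f :: "nat \<Rightarrow> nat list \<Rightarrow> nat list option" where
  "quasi_f i u =
     (if has_inversion i u \<or> i \<notin> set u then None
      else Some (u[Max {k. k < length u \<and> u ! k = i} := i + 1]))"

text \<open>An arc \<open>(u, i, v)\<close> is the edge from \<open>u\<close> to \<open>v\<close> with label \<open>i\<close>.\<close>

definition quasi_crystal_graph :: "nat \<Rightarrow> (nat list, nat list \<times> nat \<times> nat list) pre_digraph" where
  "quasi_crystal_graph n =
     \<lparr> verts = words n,
       arcs = {(u, i, v). u \<in> words n \<and> 1 \<le> i \<and> i < n \<and> quasi_f i u = Some v},
       tail = (\<lambda>(u, i, v). u),
       head = (\<lambda>(u, i, v). v) \<rparr>"

text \<open>
  Connected components of a directed graph disregard the direction of the edges, as in the
  library's definition of \<^const>\<open>connected\<close>; they are given by their vertex sets.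
\<close>

definition connected_components :: "('a, 'b) pre_digraph \<Rightarrow> 'a set set" where
  "connected_components G = pre_digraph.sccs_verts (with_proj (mk_symmetric G))"

text \<open>
  A filled ribbon diagram is the list of its rows from top to bottom, all nonempty. As the first
  box of each row lies directly below the last box of the previous one, the row lengths determine
  the shape, and \<^const>\<open>concat\<close> lists the entries along the ribbon.
\<close>

type_synonym ribbon = "nat list list"

text \<open>Cuts a ribbon into its first \<open>p\<close> cells and the remaining ones.\<close>

fun cut_ribbon :: "nat \<Rightarrow> ribbon \<Rightarrow> ribbon \<times> ribbon" where
  "cut_ribbon p [] = ([], [])"
| "cut_ribbon p (r # rs) =
     (if p = 0 then ([], r # rs)
      else if p < length r then ([take p r], drop p r # rs)
      else (let (U, L) = cut_ribbon (p - length r) rs in (r # U, L)))"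

text \<open>
  Adds a new cell with entry \<open>c\<close> after the first \<open>p\<close> cells: it goes directly right of the \<open>p\<close>-th
  cell (or forms the topmost row if \<open>p = 0\<close>), and the remaining cells are attached with the first of
  them directly below the new one. With \<open>p = 0\<close>, with \<open>p\<close> the number of cells, and with
  \<open>p\<close> strictly between, these are the three cases of the insertion.
\<close>

definition add_cell :: "nat \<Rightarrow> nat \<Rightarrow> ribbon \<Rightarrow> ribbon" where
  "add_cell p c T =
     (let (U, L) = cut_ribbon p T
      in if U = [] then [c] # L else butlast U @ [last U @ [c]] @ L)"

text \<open>The number of cells up to and including the last cell with entry \<open>\<le> a\<close>.\<close>

definition insertion_place :: "nat \<Rightarrow> ribbon \<Rightarrow> nat" where
  "insertion_place a T =
     (let xs = concat T
      in if \<exists>x \<in> set xs. x \<le> a then Suc (Max {j. j < length xs \<and> xs ! j \<le> a}) else 0)"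

text \<open>
  The pair of the tableau \<open>Q\<^sub>i\<close> and the ribbon \<open>R\<^sub>i\<close> of a word; \<open>w ! i\<close> is its letter number \<open>i + 1\<close>.
\<close>

primrec insertion_stage :: "nat list \<Rightarrow> nat \<Rightarrow> ribbon \<times> ribbon" where
  "insertion_stage w 0 = ([], [])"
| "insertion_stage w (Suc i) =
     (let (Q, R) = insertion_stage w i;
          p = insertion_place (w ! i) Q
      in (add_cell p (w ! i) Q, add_cell p (Suc i) R))"

definition recording_ribbon :: "nat list \<Rightarrow> ribbon" where
  "recording_ribbon w = snd (insertion_stage w (length w))"

end

theory Submission
  imports Defs
begin

text \<open>
  Both sides are equivalent to \<open>u\<close> and \<open>v\<close> having the same standardization, i.e. to their positions
  being ordered in the same way by (letter, position). The recording ribbon lists the positions of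
  the word in exactly this order, and its rows are determined by it. The operators
  \<open>f\<^sub>i\<close> do not change the order. Conversely, if two different words have the same
  order, take the first position in it where they differ; lowering the larger of the two letters
  there by one is an inverse quasi-Kashiwara step, and it brings the words closer together.
\<close>

section \<open>Standardization\<close>

definition before :: "nat list \<Rightarrow> nat \<Rightarrow> nat \<Rightarrow> bool" where
  "before w i j \<longleftrightarrow> w ! i < w ! j \<or> w ! i = w ! j \<and> i < j"

text \<open>For \<open>i < j\<close> the position order puts \<open>i\<close> first exactly when
  \<open>u ! i \<le> u ! j\<close>, so these comparisons encode equality of standardizations without
  building the permutations.\<close>

definition same_std :: "nat list \<Rightarrow> nat list \<Rightarrow> bool" where
  "same_std u v \<longleftrightarrow> length u = length v \<and>
     (\<forall>i j. i < j \<longrightarrow> j < length u \<longrightarrow> (u ! i \<le> u ! j \<longleftrightarrow> v ! i \<le> v ! j))"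

lemma same_std_refl: "same_std u u"
  by (simp add: same_std_def)

lemma same_std_sym: "same_std u v \<Longrightarrow> same_std v u"
  by (auto simp: same_std_def)

lemma same_std_trans: "same_std u v \<Longrightarrow> same_std v w \<Longrightarrow> same_std u w"
  by (auto simp: same_std_def)

text \<open>For \<open>j < i\<close>, \<open>before u i j\<close> is the negation of
  \<open>u ! j \<le> u ! i\<close>, and for \<open>i = j\<close> it is false; so the pairs with
  \<open>i < j\<close> carry all the information.\<close>

lemma same_std_iff_before:
  "same_std u v \<longleftrightarrow>
     length u = length v \<and> (\<forall>i < length u. \<forall>j < length u. before u i j \<longleftrightarrow> before v i j)"
proof
  assume std: "same_std u v"
  show "length u = length v \<and> (\<forall>i < length u. \<forall>j < length u. before u i j \<longleftrightarrow> before v i j)"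
  proof (intro conjI allI impI)
    fix i j
    assume "i < length u" "j < length u"
    moreover from this have "i < j \<Longrightarrow> u ! i \<le> u ! j \<longleftrightarrow> v ! i \<le> v ! j"
      and "j < i \<Longrightarrow> u ! j \<le> u ! i \<longleftrightarrow> v ! j \<le> v ! i"
      using std by (auto simp: same_std_def)
    ultimately show "before u i j \<longleftrightarrow> before v i j"
      by (cases i j rule: linorder_cases) (auto simp: before_def not_less le_less)
  qed (use std in \<open>simp add: same_std_def\<close>)
next
  assume *: "length u = length v \<and> (\<forall>i < length u. \<forall>j < length u. before u i j \<longleftrightarrow> before v i j)"
  show "same_std u v"
    unfolding same_std_def
  proof (intro conjI allI impI)
    fix i j
    assume "i < j" "j < length u"
    with * have "before u i j \<longleftrightarrow> before v i j"
      by simp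
    with \<open>i < j\<close> show "u ! i \<le> u ! j \<longleftrightarrow> v ! i \<le> v ! j"
      by (auto simp: before_def)
  qed (use * in simp)
qed

section \<open>Quasi-Kashiwara operators\<close>

lemma quasi_f_eq_SomeI:
  assumes "\<not> has_inversion i u" and p: "p < length u" "u ! p = i"
    and last: "\<And>q. p < q \<Longrightarrow> q < length u \<Longrightarrow> u ! q \<noteq> i"
  shows "quasi_f i u = Some (u[p := i + 1])"
proof -
  have "Max {k. k < length u \<and> u ! k = i} = p"
  proof (rule Max_eqI)
    fix q
    assume "q \<in> {k. k < length u \<and> u ! k = i}"
    then show "q \<le> p"
      using last[of q] by (cases "q \<le> p") auto
  qed (use p in auto)
  then show ?thesis
    using assms(1) p unfolding quasi_f_def by (auto simp: in_set_conv_nth)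
qed

lemma quasi_f_SomeE:
  assumes "quasi_f i u = Some v"
  obtains p where "\<not> has_inversion i u" "p < length u" "u ! p = i"
    "\<forall>q. p < q \<longrightarrow> q < length u \<longrightarrow> u ! q \<noteq> i" "v = u[p := i + 1]"
proof -
  let ?K = "{k. k < length u \<and> u ! k = i}"
  have inv: "\<not> has_inversion i u" and mem: "i \<in> set u" and v: "v = u[Max ?K := i + 1]"
    using assms by (auto simp: quasi_f_def split: if_splits)
  have "?K \<noteq> {}"
    using mem by (auto simp: in_set_conv_nth)
  then have "Max ?K \<in> ?K"
    by (intro Max_in) auto
  moreover have "q \<le> Max ?K" if "q < length u" "u ! q = i" for q
    using that by (intro Max_ge) auto
  ultimately show thesis
    using inv v by (intro that[of "Max ?K"]) (auto simp: leD)
qed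

text \<open>Raising position \<open>p\<close> from \<open>i\<close> to \<open>i + 1\<close> could
  only affect the comparison with an \<open>i\<close> to its right or with an \<open>i + 1\<close>
  to its left. The choice of the rightmost \<open>i\<close> excludes the former, the absence of an
  inversion the latter.\<close>

lemma quasi_f_same_std:
  assumes "quasi_f i u = Some v"
  shows "same_std u v"
proof -
  obtain p where inv: "\<not> has_inversion i u" and p: "p < length u" "u ! p = i"
    and last: "\<forall>q. p < q \<longrightarrow> q < length u \<longrightarrow> u ! q \<noteq> i" and v: "v = u[p := i + 1]"
    using assms by (rule quasi_f_SomeE)
  have noinv: "u ! q \<noteq> i + 1" if "q < p" for q
    using inv that p unfolding has_inversion_def by blast
  show ?thesis
    unfolding same_std_def
  proof (intro conjI allI impI)
    fix j k
    assume "j < k" "k < length u"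
    then show "u ! j \<le> u ! k \<longleftrightarrow> v ! j \<le> v ! k"
      using p noinv[of j] last by (cases "j = p"; cases "k = p") (auto simp: v)
  qed (simp add: v)
qed

lemma quasi_f_words:
  assumes "quasi_f i u = Some v" "u \<in> words n" "i < n"
  shows "v \<in> words n"
  using assms(1)
proof (rule quasi_f_SomeE)
  fix p
  assume "v = u[p := i + 1]"
  then show ?thesis
    using assms(2,3) set_update_subsetI[of u "{1..n}" "i + 1" p] by (simp add: words_def lists_eq_set)
qed

text \<open>The obstructions would be a letter \<open>u ! p - 1\<close> to the right of
  \<open>p\<close> or a letter \<open>u ! p\<close> to its left. Either position comes before
  \<open>p\<close>, so \<open>u\<close> and \<open>v\<close> agree there, and the common
  standardization then forces \<open>v ! p \<ge> u ! p\<close>.\<close>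

lemma quasi_f_lower_first_difference:
  assumes std: "same_std u v" and p: "p < length u" "v ! p < u ! p"
    and agree: "\<forall>q < length u. before u q p \<longrightarrow> u ! q = v ! q"
  shows "quasi_f (u ! p - 1) (u[p := u ! p - 1]) = Some u"
proof -
  define i where "i = u ! p - 1"
  \<comment> \<open>The truncated subtraction is harmless: \<open>u ! p\<close> exceeds
    \<open>v ! p\<close>, hence is positive.\<close>
  have up: "u ! p = i + 1"
    using p by (simp add: i_def)
  let ?u = "u[p := i]"
  have le: "u ! j \<le> u ! k \<longleftrightarrow> v ! j \<le> v ! k" if "j < k" "k < length u" for j k
    using std that by (simp add: same_std_def)
  have right: "u ! q \<noteq> i" if "p < q" "q < length u" for q
  proof
    assume uq: "u ! q = i"
    then have "before u q p"
      by (simp add: before_def up)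
    then have "v ! q = i"
      using agree that(2) uq by metis
    moreover have "\<not> v ! p \<le> v ! q"
      using le[OF that] uq up by linarith
    ultimately show False
      using p(2) up by linarith
  qed
  have "\<not> has_inversion i ?u"
  proof
    assume "has_inversion i ?u"
    then obtain a b where ab: "a < b" "b < length u" "?u ! a = i + 1" "?u ! b = i"
      by (auto simp: has_inversion_def)
    then have "a \<noteq> p"
      using p by auto
    then have ua: "u ! a = i + 1"
      using ab by simp
    \<comment> \<open>No \<open>i\<close> lies beyond \<open>p\<close>, so the \<open>i + 1\<close>
      of the supposed inversion stands strictly left of \<open>p\<close>.\<close>
    have "b \<le> p"
      using right[of b] ab by (cases "b \<le> p") auto
    with ab(1) have "a < p"
      by simp
    then have "before u a p"
      by (simp add: before_def ua up)
    then have "v ! a = i + 1"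
      using agree \<open>a < p\<close> p(1) ua by (metis less_trans)
    moreover have "v ! a \<le> v ! p"
      using le[OF \<open>a < p\<close> p(1)] ua up by linarith
    ultimately show False
      using p(2) up by linarith
  qed
  then have "quasi_f i ?u = Some (?u[p := i + 1])"
    using p(1) right by (intro quasi_f_eq_SomeI) simp_all
  also have "?u[p := i + 1] = u"
    unfolding list_update_overwrite up[symmetric] by (rule list_update_id)
  finally show ?thesis
    by (simp add: i_def)
qed

section \<open>Connected components of the quasi-crystal graph\<close>

text \<open>Reachability in the symmetrized graph is symmetric, so the mutual reachability that
  characterizes strongly connected components reduces to a single direction.\<close>

lemma connected_components_iff_reachable:
  assumes "wf_digraph G" "u \<in> verts G"
  shows "(\<exists>C \<in> connected_components G. u \<in> C \<and> v \<in> C) \<longleftrightarrow>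
    reachable (with_proj (mk_symmetric G)) u v"
proof -
  interpret S: pair_wf_digraph "mk_symmetric G"
    using assms(1) by (rule wf_digraph.wellformed_mk_symmetric)
  show ?thesis
  proof
    assume uv: "reachable (with_proj (mk_symmetric G)) u v"
    then have "reachable (with_proj (mk_symmetric G)) v u"
      by (rule symmetric_reachable[OF symmetric_mk_symmetric])
    with uv have "v \<in> S.scc_of u"
      unfolding S.scc_of_def by (intro CollectI conjI)
    moreover have u: "u \<in> pverts (mk_symmetric G)"
      using assms(2) by simp
    then have "u \<in> S.scc_of u"
      by (rule S.in_scc_of_self)
    moreover have "S.scc_of u \<in> connected_components G"
      unfolding connected_components_def using u by (rule S.scc_of_in_sccs_verts)
    ultimately show "\<exists>C \<in> connected_components G. u \<in> C \<and> v \<in> C"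
      by blast
  next
    assume "\<exists>C \<in> connected_components G. u \<in> C \<and> v \<in> C"
    then obtain C where C: "C \<in> S.sccs_verts" "u \<in> C" "v \<in> C"
      unfolding connected_components_def by (elim bexE conjE)
    from C(1) have "\<forall>x \<in> C. \<forall>y \<in> C. reachable (with_proj (mk_symmetric G)) x y"
      unfolding S.in_sccs_verts_conv_reachable by (elim conjE)
    from bspec[OF bspec[OF this C(2)] C(3)]
    show "reachable (with_proj (mk_symmetric G)) u v" .
  qed
qed

lemma wf_quasi_crystal_graph: "wf_digraph (quasi_crystal_graph n)"
  by unfold_locales (auto simp: quasi_crystal_graph_def intro: quasi_f_words)

abbreviation crystal_connected :: "nat \<Rightarrow> nat list \<Rightarrow> nat list \<Rightarrow> bool" where
  "crystal_connected n \<equiv> reachable (with_proj (mk_symmetric (quasi_crystal_graph n)))"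

lemma crystal_connected_sym: "crystal_connected n u v \<Longrightarrow> crystal_connected n v u"
  by (rule symmetric_reachable[OF symmetric_mk_symmetric])

lemma crystal_connected_same_std:
  assumes "crystal_connected n u v"
  shows "same_std u v"
proof -
  interpret S: pair_wf_digraph "mk_symmetric (quasi_crystal_graph n)"
    using wf_quasi_crystal_graph by (rule wf_digraph.wellformed_mk_symmetric)
  from assms show ?thesis
  proof (induction rule: S.reachable_induct)
    case base
    show ?case
      by (rule same_std_refl)
  next
    case (step x y)
    then have "same_std x y"
      \<comment> \<open>An arc of the symmetrized graph may be an edge traversed backwards, which is
        why \<open>same_std_sym\<close> is needed.\<close>
      by (auto simp: parcs_mk_symmetric quasi_crystal_graph_def
          intro: quasi_f_same_std same_std_sym)
    with step.IH show ?case
      by (rule same_std_trans)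
  qed
qed

section \<open>Connecting words with equal standardization\<close>

text \<open>One step of the descent: only the letter at \<open>p\<close> changes, moving by one
  towards the smaller \<open>v ! p\<close>, so the sum of the letterwise distances drops.\<close>

lemma lower_first_difference_connected:
  assumes u: "u \<in> words n" and v: "v \<in> words n" and std: "same_std u v"
    and p: "p < length u" "v ! p < u ! p"
    and agree: "\<forall>q < length u. before u q p \<longrightarrow> u ! q = v ! q"
  obtains u' where "u' \<in> words n" "crystal_connected n u u'" "same_std u' v"
    "(\<Sum>j<length u'. nat \<bar>int (u' ! j) - int (v ! j)\<bar>)
       < (\<Sum>j<length u. nat \<bar>int (u ! j) - int (v ! j)\<bar>)"
proof
  let ?i = "u ! p - 1"
  let ?u = "u[p := ?i]"
  interpret S: pair_wf_digraph "mk_symmetric (quasi_crystal_graph n)"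
    using wf_quasi_crystal_graph by (rule wf_digraph.wellformed_mk_symmetric)
  have f: "quasi_f ?i ?u = Some u"
    using std p agree by (rule quasi_f_lower_first_difference)
  have "u ! p \<in> {1..n}" "v ! p \<in> {1..n}"
    using u v p std nth_mem[of p u] nth_mem[of p v]
    by (auto simp: words_def same_std_def simp del: nth_mem)
  \<comment> \<open>From \<open>1 \<le> v ! p < u ! p \<le> n\<close>; this makes \<open>?i\<close>
    both an admissible label and a letter of the alphabet.\<close>
  then have i: "1 \<le> ?i" "?i < n"
    using p by auto
  then show words: "?u \<in> words n"
    using u i set_update_subsetI[of u "{1..n}" ?i p] by (simp add: words_def lists_eq_set)
  have "(u, ?u) \<in> parcs (mk_symmetric (quasi_crystal_graph n))"
    using f i words by (force simp: parcs_mk_symmetric quasi_crystal_graph_def)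
  then show "crystal_connected n u ?u"
    by (intro S.reachable_adjI) simp
  show "same_std ?u v"
    using quasi_f_same_std[OF f] std by (rule same_std_trans)
  show "(\<Sum>j<length ?u. nat \<bar>int (?u ! j) - int (v ! j)\<bar>)
       < (\<Sum>j<length u. nat \<bar>int (u ! j) - int (v ! j)\<bar>)"
    unfolding length_list_update
  proof (rule sum_strict_mono_ex1)
    show "\<forall>j\<in>{..<length u}.
        nat \<bar>int (?u ! j) - int (v ! j)\<bar> \<le> nat \<bar>int (u ! j) - int (v ! j)\<bar>"
      using p by (auto simp: nth_list_update)
    show "\<exists>j\<in>{..<length u}.
        nat \<bar>int (?u ! j) - int (v ! j)\<bar> < nat \<bar>int (u ! j) - int (v ! j)\<bar>"
      using p by (intro bexI[of _ p]) auto
  qed simp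
qed

text \<open>\<open>before u\<close> is the lexicographic order on pairs (letter, position), which is
  well-founded; \<open>p\<close> is a minimal element of the set of differing positions.\<close>

lemma obtain_first_difference:
  assumes "length u = length v" "u \<noteq> v"
  obtains p where "p < length u" "u ! p \<noteq> v ! p"
    "\<forall>q < length u. before u q p \<longrightarrow> u ! q = v ! q"
proof -
  define D where "D = {p. p < length u \<and> u ! p \<noteq> v ! p}"
  obtain x where "x \<in> D"
    using assms by (auto simp: D_def list_eq_iff_nth_eq)
  have wf: "wf (inv_image (less_than <*lex*> less_than) (\<lambda>p. (u ! p, p)))"
    by auto
  obtain p where p: "p \<in> D"
    and min: "\<forall>q. (q, p) \<in> inv_image (less_than <*lex*> less_than) (\<lambda>p. (u ! p, p)) \<longrightarrow> q \<notin> D"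
    using wf[unfolded wf_eq_minimal, rule_format, OF \<open>x \<in> D\<close>] by (elim bexE)
  show thesis
  proof (rule that)
    show "\<forall>q < length u. before u q p \<longrightarrow> u ! q = v ! q"
      using min by (auto simp: D_def before_def)
  qed (use p in \<open>simp_all add: D_def\<close>)
qed

text \<open>Induction on the sum of the letterwise distances. Both words vary, since either may have
  the larger letter at the first difference and be the one that is lowered.\<close>

lemma same_std_crystal_connected:
  assumes "u \<in> words n" "v \<in> words n" "same_std u v"
  shows "crystal_connected n u v"
  using assms
proof (induction "\<Sum>j<length u. nat \<bar>int (u ! j) - int (v ! j)\<bar>" arbitrary: u v rule: less_induct)
  case less
  interpret S: pair_wf_digraph "mk_symmetric (quasi_crystal_graph n)"
    using wf_quasi_crystal_graph by (rule wf_digraph.wellformed_mk_symmetric)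
  have len: "length u = length v"
    using less.prems(3) by (simp add: same_std_def)
  show ?case
  proof (cases "u = v")
    case True
    then show ?thesis
      using less.prems S.reachable_refl[of u] by (simp add: quasi_crystal_graph_def)
  next
    case False
    with len obtain p where p: "p < length u" "u ! p \<noteq> v ! p"
      and agree: "\<forall>q < length u. before u q p \<longrightarrow> u ! q = v ! q"
      by (rule obtain_first_difference)
    consider "v ! p < u ! p" | "u ! p < v ! p"
      using p by linarith
    then show ?thesis
    proof cases
      case 1
      obtain u' where "u' \<in> words n" and conn: "crystal_connected n u u'" and "same_std u' v"
        "(\<Sum>j<length u'. nat \<bar>int (u' ! j) - int (v ! j)\<bar>)
           < (\<Sum>j<length u. nat \<bar>int (u ! j) - int (v ! j)\<bar>)"
        using less.prems p(1) 1 agree by (rule lower_first_difference_connected)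
      then have "crystal_connected n u' v"
        using less.hyps less.prems by blast
      with conn show ?thesis
        by (rule S.reachable_trans)
    next
      case 2
      \<comment> \<open>The two position orders coincide, so \<open>p\<close> is also the first
        difference in the order of \<open>v\<close>, and the roles of the words can be
        exchanged.\<close>
      have agree': "\<forall>q < length v. before v q p \<longrightarrow> v ! q = u ! q"
        using agree less.prems(3) p(1) len by (simp add: same_std_iff_before)
      have p': "p < length v"
        using p(1) len by simp
      obtain v' where v': "v' \<in> words n" and conn: "crystal_connected n v v'" and std: "same_std v' u"
        and dec: "(\<Sum>j<length v'. nat \<bar>int (v' ! j) - int (u ! j)\<bar>)
           < (\<Sum>j<length v. nat \<bar>int (v ! j) - int (u ! j)\<bar>)"
        using less.prems(2,1) same_std_sym[OF less.prems(3)] p' 2 agree'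
        by (rule lower_first_difference_connected)
      have "crystal_connected n v' u"
        using less.hyps[of v' u] dec v' std less.prems(1) len by (simp add: abs_minus_commute)
      with conn have "crystal_connected n v u"
        by (rule S.reachable_trans)
      then show ?thesis
        by (rule crystal_connected_sym)
    qed
  qed
qed

section \<open>Recording ribbons\<close>

lemma cut_ribbon_map:
  "cut_ribbon p (map (map f) T) = map_prod (map (map f)) (map (map f)) (cut_ribbon p T)"
  by (induction p T rule: cut_ribbon.induct) (auto simp: take_map drop_map split: prod.splits)

lemma concat_cut_ribbon:
  "cut_ribbon p T = (U, L) \<Longrightarrow> concat U = take p (concat T) \<and> concat L = drop p (concat T)"
  by (induction p T arbitrary: U L rule: cut_ribbon.induct) (auto split: if_splits prod.splits)

text \<open>Where the new cell goes depends on \<open>p\<close> and the shape only, not on the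
  entries. This allows the tableau and the recording ribbon to be compared by relabelling.\<close>

lemma add_cell_map: "add_cell p (f c) (map (map f) T) = map (map f) (add_cell p c T)"
  by (auto simp: add_cell_def cut_ribbon_map map_butlast last_map split: prod.splits)

text \<open>Along the ribbon, adding a cell is plain list insertion, so arguments about the order of
  entries can ignore the rows.\<close>

lemma concat_add_cell: "concat (add_cell p c T) = take p (concat T) @ c # drop p (concat T)"
proof -
  obtain U L where UL: "cut_ribbon p T = (U, L)"
    by (cases "cut_ribbon p T")
  have "concat U = concat (butlast U) @ last U" if "U \<noteq> []"
    using arg_cong[OF append_butlast_last_id[OF that], of concat] by simp
  then show ?thesis
    using concat_cut_ribbon[OF UL] by (auto simp: add_cell_def UL)
qed

text \<open>In a sorted ribbon the entries \<open>\<le> a\<close> form an initial segment, and the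
  insertion place is its length.\<close>

lemma insertion_place_sorted:
  assumes "sorted (concat T)"
  shows "\<forall>x \<in> set (take (insertion_place a T) (concat T)). x \<le> a"
    and "\<forall>x \<in> set (drop (insertion_place a T) (concat T)). a < x"
proof -
  let ?xs = "concat T"
  let ?J = "{j. j < length ?xs \<and> ?xs ! j \<le> a}"
  have "(\<forall>x \<in> set (take (insertion_place a T) ?xs). x \<le> a) \<and>
    (\<forall>x \<in> set (drop (insertion_place a T) ?xs). a < x)"
  proof (cases "\<exists>x \<in> set ?xs. x \<le> a")
    case False
    then have "insertion_place a T = 0"
      unfolding insertion_place_def Let_def by (rule if_not_P)
    with False show ?thesis
      by (simp add: not_le)
  next
    case True
    then have place: "insertion_place a T = Suc (Max ?J)"
      unfolding insertion_place_def Let_def by (rule if_P)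
    have "?J \<noteq> {}"
      using True by (auto simp: in_set_conv_nth simp del: set_concat)
    then have M: "Max ?J \<in> ?J"
      by (intro Max_in) auto
    have "?xs ! j \<le> a" if "j < Suc (Max ?J)" for j
      using sorted_nth_mono[OF assms, of j "Max ?J"] M that by auto
    moreover have "a < ?xs ! j" if "Max ?J < j" "j < length ?xs" for j
    proof (rule ccontr)
      assume "\<not> a < ?xs ! j"
      then have "j \<le> Max ?J"
        using that by (intro Max_ge) auto
      with that show False
        by simp
    qed
    ultimately show ?thesis
      unfolding place by (auto simp: in_set_conv_nth simp del: set_concat)
  qed
  then show "\<forall>x \<in> set (take (insertion_place a T) ?xs). x \<le> a"
    and "\<forall>x \<in> set (drop (insertion_place a T) ?xs). a < x"
    by auto
qed

section \<open>The recording ribbon as a sorted list of positions\<close>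

lemma insertion_stage_Suc:
  fixes w i
  defines "p \<equiv> insertion_place (w ! i) (fst (insertion_stage w i))"
  shows "fst (insertion_stage w (Suc i)) = add_cell p (w ! i) (fst (insertion_stage w i))"
    and "snd (insertion_stage w (Suc i)) = add_cell p (Suc i) (snd (insertion_stage w i))"
  by (simp_all add: p_def Let_def split_beta)

text \<open>Both ribbons grow at the same place, so \<open>add_cell_map\<close> carries the
  induction. Labels start at 1 and list indices at 0, hence the shift \<open>j - 1\<close>. The
  recording ribbon and the word thus determine the tableau.\<close>

lemma tableau_eq_map_recording:
  "fst (insertion_stage w i) = map (map (\<lambda>j. w ! (j - 1))) (snd (insertion_stage w i))"
proof (induction i)
  case (Suc i)
  show ?case
    unfolding insertion_stage_Suc
    by (metis (no_types, lifting) Suc.IH add_cell_map diff_Suc_1)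
qed simp

lemma set_concat_recording: "set (concat (snd (insertion_stage w i))) = {1..i}"
proof (induction i)
  case (Suc i)
  have "set (take p xs @ x # drop p xs) = insert x (set xs)" for p x and xs :: "nat list"
    \<comment> \<open>The third occurrence of \<open>xs\<close> is the one on the right-hand side,
      which is split to match the left.\<close>
    by (subst (3) append_take_drop_id[of p xs, symmetric])
      (simp only: set_append list.set Un_insert_right)
  then show ?case
    using Suc unfolding insertion_stage_Suc concat_add_cell
    by (simp add: atLeastAtMostSuc_conv del: set_concat)
qed simp

text \<open>The new cell follows all letters \<open>\<le> w ! i\<close> and precedes all larger
  ones. Equal letters end up before it, as the order demands, since their positions are
  smaller.\<close>

lemma sorted_recording:
  "sorted_wrt (\<lambda>j k. before w (j - 1) (k - 1)) (concat (snd (insertion_stage w i)))"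
proof (induction i)
  case (Suc i)
  define R where "R = concat (snd (insertion_stage w i))"
  define p where "p = insertion_place (w ! i) (fst (insertion_stage w i))"
  have Q: "concat (fst (insertion_stage w i)) = map (\<lambda>j. w ! (j - 1)) R"
    unfolding R_def tableau_eq_map_recording by (simp add: map_concat)
  have sorted_R: "sorted_wrt (\<lambda>j k. before w (j - 1) (k - 1)) R"
    using Suc unfolding R_def .
  then have "sorted (concat (fst (insertion_stage w i)))"
    unfolding Q sorted_map
    by (rule sorted_wrt_mono_rel[rotated]) (auto simp: before_def)
  from insertion_place_sorted[OF this, of "w ! i"]
  have le: "\<forall>j \<in> set (take p R). w ! (j - 1) \<le> w ! i"
    and gt: "\<forall>j \<in> set (drop p R). w ! i < w ! (j - 1)"
    unfolding Q p_def[symmetric] take_map drop_map by simp_all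
  have "sorted_wrt (\<lambda>j k. before w (j - 1) (k - 1)) (take p R @ drop p R)"
    using sorted_R by simp
  moreover have "before w (j - 1) (Suc i - 1)" if "j \<in> set (take p R)" for j
  proof -
    \<comment> \<open>This gives \<open>j - 1 < i\<close>, which settles the case of equal
      letters.\<close>
    have "j \<in> {1..i}"
      using that set_concat_recording[of w i] in_set_takeD unfolding R_def by metis
    then show ?thesis
      using le that by (fastforce simp: before_def)
  qed
  moreover have "before w (Suc i - 1) (k - 1)" if "k \<in> set (drop p R)" for k
    using gt that by (simp add: before_def)
  ultimately show ?case
    unfolding insertion_stage_Suc concat_add_cell p_def[symmetric] R_def[symmetric] sorted_wrt_append
    by auto
qed simp

section \<open>Recording ribbons and standardization determine each other\<close>

text \<open>The indices of \<open>a\<close> and \<open>b\<close> in \<open>xs\<close> decide both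
  relations: the earlier entry is related to the later one, and asymmetry refutes the converse and
  the case of equal indices.\<close>

lemma sorted_wrt_two_orders:
  assumes "sorted_wrt P xs" "sorted_wrt Q xs" "a \<in> set xs" "b \<in> set xs"
    and "asymp P" "asymp Q"
  shows "P a b \<longleftrightarrow> Q a b"
proof -
  obtain j k where jk: "j < length xs" "k < length xs" "a = xs ! j" "b = xs ! k"
    using assms(3,4) by (auto simp: in_set_conv_nth)
  then show ?thesis
    using assms(1,2,5,6) by (metis asympD linorder_neqE_nat sorted_wrt_nth_less)
qed

lemma recording_ribbon_imp_same_std:
  assumes "recording_ribbon u = recording_ribbon v"
  shows "same_std u v"
proof -
  define R where "R = concat (recording_ribbon u)"
  have R: "set R = {1..length u}" "set R = {1..length v}"
    using set_concat_recording[of u "length u"] set_concat_recording[of v "length v"] assms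
    by (simp_all add: R_def recording_ribbon_def)
  \<comment> \<open>The set of labels in the common ribbon recovers the length of the word.\<close>
  have "card {1..length u} = card {1..length v}"
    unfolding R[symmetric] by (rule refl)
  then have len: "length u = length v"
    by simp
  have sorted: "sorted_wrt (\<lambda>j k. before u (j - 1) (k - 1)) R"
    "sorted_wrt (\<lambda>j k. before v (j - 1) (k - 1)) R"
    using sorted_recording[of u "length u"] sorted_recording[of v "length v"] assms
    by (simp_all add: R_def recording_ribbon_def)
  have "asymp (\<lambda>j k. before w (j - 1) (k - 1))" for w
    by (rule asympI) (auto simp: before_def)
  note iff = sorted_wrt_two_orders[OF sorted _ _ this this]
  have "before u i j \<longleftrightarrow> before v i j" if "i < length u" "j < length u" for i j
    using iff[of "Suc i" "Suc j"] that by (simp add: R)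
  with len show ?thesis
    by (simp add: same_std_iff_before)
qed

text \<open>The insertion place depends only on which earlier letters are \<open>\<le>\<close> the
  new one. These are comparisons of a position \<open>k - 1 < i\<close> with \<open>i\<close>,
  exactly those on which the two words agree.\<close>

lemma same_std_imp_stage_eq:
  assumes "same_std u v" "i \<le> length u"
  shows "snd (insertion_stage u i) = snd (insertion_stage v i)"
  using assms(2)
proof (induction i)
  case (Suc i)
  define R where "R = snd (insertion_stage u i)"
  have R: "snd (insertion_stage v i) = R"
    using Suc by (simp add: R_def)
  have set_R: "set (concat R) = {1..i}"
    unfolding R_def by (rule set_concat_recording)
  have concat_Q: "concat (fst (insertion_stage w i)) = map (\<lambda>j. w ! (j - 1)) (concat R)"
    if "snd (insertion_stage w i) = R" for w
    unfolding tableau_eq_map_recording that by (simp add: map_concat)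
  have le: "u ! (k - 1) \<le> u ! i \<longleftrightarrow> v ! (k - 1) \<le> v ! i" if "k \<in> set (concat R)" for k
  proof -
    have "k - 1 < i"
      using that unfolding set_R by auto
    then show ?thesis
      using assms(1) Suc.prems by (simp add: same_std_def)
  qed
  have "(\<exists>x \<in> set (map (\<lambda>j. u ! (j - 1)) (concat R)). x \<le> u ! i) \<longleftrightarrow>
    (\<exists>x \<in> set (map (\<lambda>j. v ! (j - 1)) (concat R)). x \<le> v ! i)"
    using le by (auto simp del: set_concat)
  moreover have "{j. j < length (map (\<lambda>j. u ! (j - 1)) (concat R)) \<and>
      map (\<lambda>j. u ! (j - 1)) (concat R) ! j \<le> u ! i} =
    {j. j < length (map (\<lambda>j. v ! (j - 1)) (concat R)) \<and>
      map (\<lambda>j. v ! (j - 1)) (concat R) ! j \<le> v ! i}"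
    using le nth_mem[of _ "concat R"] by (auto simp del: set_concat nth_mem)
  ultimately have "insertion_place (u ! i) (fst (insertion_stage u i)) =
    insertion_place (v ! i) (fst (insertion_stage v i))"
    unfolding insertion_place_def Let_def concat_Q[OF R_def[symmetric]] concat_Q[OF R] by simp
  then show ?case
    unfolding insertion_stage_Suc R by (simp add: R_def)
qed simp

lemma recording_ribbon_eq_iff_same_std: "recording_ribbon u = recording_ribbon v \<longleftrightarrow> same_std u v"
proof
  assume "same_std u v"
  then show "recording_ribbon u = recording_ribbon v"
    using same_std_imp_stage_eq[of u v "length u"]
    by (simp add: recording_ribbon_def same_std_def)
qed (rule recording_ribbon_imp_same_std)

theorem theorem7p1:
  fixes n :: nat and u v :: "nat list"
  assumes "u \<in> words n" and "v \<in> words n"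
  shows "(\<exists>C \<in> connected_components (quasi_crystal_graph n). u \<in> C \<and> v \<in> C)
     \<longleftrightarrow> recording_ribbon u = recording_ribbon v"
proof -
  have "u \<in> verts (quasi_crystal_graph n)"
    using assms(1) by (simp add: quasi_crystal_graph_def)
  then have "(\<exists>C \<in> connected_components (quasi_crystal_graph n). u \<in> C \<and> v \<in> C) \<longleftrightarrow>
      crystal_connected n u v"
    by (rule connected_components_iff_reachable[OF wf_quasi_crystal_graph])
  also have "\<dots> \<longleftrightarrow> same_std u v"
    using assms crystal_connected_same_std same_std_crystal_connected by blast
  also have "\<dots> \<longleftrightarrow> recording_ribbon u = recording_ribbon v"
    by (rule recording_ribbon_eq_iff_same_std[symmetric])
  finally show ?thesis .
qed

end
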